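(* Let $\mathscr{M}=(S,\rho)$ be a matroid scheme and $a\in\mathrm{at}(S)$. (1) If $a$ is neither a loop nor an isthmus, then $T_{\mathscr{M}}(\mathrm{x},\mathrm{y})=T_{\mathscr{M}-a}(\mathrm{x},\mathrm{y})+T_{\mathscr{M}_{/a}}(\mathrm{x},\mathrm{y})$. (2) If $a$ is a loop, then $T_{\mathscr{M}}(\mathrm{x},\mathrm{y})=\mathrm{y}\,T_{\mathscr{M}_{/a}}(\mathrm{x},\mathrm{y})$. (3) If $a$ is an isthmus, then $T_{\mathscr{M}}(\mathrm{x},\mathrm{y})=(\mathrm{x}-1)T_{\mathscr{M}-a}(\mathrm{x},\mathrm{y})+T_{\mathscr{M}_{/a}}(\mathrm{x},\mathrm{y})$.
   Context: A finite poset $S$ is a simplicial poset if it has a unique minimum $\hat 0$, is ranked (rank function with $\mathrm{rank}(\hat0)=0$ increasing by one along covers), and each lower interval $S_{\le x}$ is isomorphic to the Boolean lattice of subsets of the atoms (rank-one elements) below $x$. Write $|x|$ for the rank of $x$, $\mathrm{at}(S)$ for the atoms. For $T\subseteq S$, $\bigvee T$ is the set of minimal common upper bounds, $\bigwedge T$ the set of maximal common lower bounds; $x\vee y=\bigvee\{x,y\}$, $x\wedge y=\bigwedge\{x,y\}$ (a single element when $x\vee y\neq\emptyset$). A matroid scheme is $(S,\rho)$ with $S$ a finite simplicial poset, $\rho:S\to\mathbb{Z}_{\ge0}$, satisfying: (M1) $0\le\rho(x)\le|x|$; (M2) $x\le y\Rightarrow\rho(x)\le\rho(y)$; (M3) $u\in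 x\vee y\Rightarrow\rho(x)+\rho(y)\ge\rho(u)+\rho(x\wedge y)$; (M4) if $\ell\in x\wedge y$ and $\rho(x)=\rho(\ell)$ then $x\vee y\ne\emptyset$; (M5) if $\rho(x)<\rho(y)$ there is an atom $a\le y$, $a\not\le x$, with $x\vee a\ne\emptyset$. The rank $\rho(\mathscr{M})$ is $\rho(u)$ for any maximal $u\in S$ (independent of $u$). An element $x$ is independent if $\rho(x)=|x|$; a basis is a maximal independent element. An atom $a$ is a loop if $\rho(a)=0$, and an isthmus if $a\le b$ for every basis $b$. The deletion is $\mathscr{M}-a=(S_{\not\ge a},\rho|_{S_{\not\ge a}})$ with $S_{\not\ge a}=\{x\in S: x\not\ge a\}$; the contraction is $\mathscr{M}_{/a}=(S_{\ge a},\rho_{/a})$ with $\rho_{/a}(w)=\rho(w)-\rho(a)$; both are matroid schemes. The Tutte polynomial is $T_{\mathscr{M}}(\mathrm{x},\mathrm{y})=\sum_{w\in S}(\mathrm{x}-1)^{\rho(\mathscr{M})-\rho(w)}(\mathrm{y}-1)^{|w|-\rho(w)}$ (for $\mathscr{M}_{/a}$, $|w|$ is the rank of $w$ in $S_{\ge a}$, i.e. $|w|-1$ in $S$, and its rank function is $\rho_{/a}$). *)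

theory Defs
  imports "HOL-Computational_Algebra.Polynomial"
begin

section \<open>Finite posets\<close>

text \<open>Only the values of the order on the carrier matter, so a subposet keeps the same relation
  and just shrinks the carrier.\<close>

record 'a poset =
  elts :: "'a set"
  le :: "'a \<Rightarrow> 'a \<Rightarrow> bool"

definition finite_poset :: "('a, 'm) poset_scheme \<Rightarrow> bool" where
  "finite_poset P \<longleftrightarrow> finite (elts P) \<and>
     reflp_on (elts P) (le P) \<and> antisymp_on (elts P) (le P) \<and> transp_on (elts P) (le P)"

definition is_minimum :: "('a, 'm) poset_scheme \<Rightarrow> 'a \<Rightarrow> bool" where
  "is_minimum P z \<longleftrightarrow> z \<in> elts P \<and> (\<forall>x\<in>elts P. le P z x)"

definition minimal_elts :: "('a, 'm) poset_scheme \<Rightarrow> 'a set \<Rightarrow> 'a set" where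
  "minimal_elts P A = {x \<in> A. \<forall>y\<in>A. le P y x \<longrightarrow> y = x}"

definition maximal_elts :: "('a, 'm) poset_scheme \<Rightarrow> 'a set \<Rightarrow> 'a set" where
  "maximal_elts P A = {x \<in> A. \<forall>y\<in>A. le P x y \<longrightarrow> y = x}"

definition Joins :: "('a, 'm) poset_scheme \<Rightarrow> 'a set \<Rightarrow> 'a set" where
  "Joins P T = minimal_elts P {u \<in> elts P. \<forall>t\<in>T. le P t u}"

definition Meets :: "('a, 'm) poset_scheme \<Rightarrow> 'a set \<Rightarrow> 'a set" where
  "Meets P T = maximal_elts P {l \<in> elts P. \<forall>t\<in>T. le P l t}"

abbreviation joins :: "('a, 'm) poset_scheme \<Rightarrow> 'a \<Rightarrow> 'a \<Rightarrow> 'a set" where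
  "joins P x y \<equiv> Joins P {x, y}"

abbreviation meets :: "('a, 'm) poset_scheme \<Rightarrow> 'a \<Rightarrow> 'a \<Rightarrow> 'a set" where
  "meets P x y \<equiv> Meets P {x, y}"

definition covers :: "('a, 'm) poset_scheme \<Rightarrow> 'a \<Rightarrow> 'a \<Rightarrow> bool" where
  "covers P x y \<longleftrightarrow> x \<in> elts P \<and> y \<in> elts P \<and> le P x y \<and> x \<noteq> y \<and>
     (\<forall>z\<in>elts P. le P x z \<and> le P z y \<longrightarrow> z = x \<or> z = y)"

definition is_rank_function :: "('a, 'm) poset_scheme \<Rightarrow> ('a \<Rightarrow> nat) \<Rightarrow> bool" where
  "is_rank_function P r \<longleftrightarrow>
     (\<forall>z. is_minimum P z \<longrightarrow> r z = 0) \<and> (\<forall>x y. covers P x y \<longrightarrow> r y = r x + 1)"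

text \<open>In a finite poset with a minimum, a rank function is determined on the carrier, so there
  the choice below does not matter.\<close>

definition rank :: "('a, 'm) poset_scheme \<Rightarrow> 'a \<Rightarrow> nat" where
  "rank P = (SOME r. is_rank_function P r)"

definition atoms :: "('a, 'm) poset_scheme \<Rightarrow> 'a set" where
  "atoms P = {x \<in> elts P. rank P x = 1}"

definition boolean_below :: "('a, 'm) poset_scheme \<Rightarrow> 'a \<Rightarrow> bool" where
  "boolean_below P x \<longleftrightarrow>
     (\<exists>f. bij_betw f {y \<in> elts P. le P y x} (Pow {a \<in> atoms P. le P a x}) \<and>
        (\<forall>y\<in>{y \<in> elts P. le P y x}. \<forall>z\<in>{y \<in> elts P. le P y x}. le P y z \<longleftrightarrow> f y \<subseteq> f z))"

locale simplicial_poset =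
  fixes P :: "('a, 'm) poset_scheme"
  assumes finite_poset: "finite_poset P"
    and ex1_minimum: "\<exists>!z. is_minimum P z"
    and ranked: "\<exists>r. is_rank_function P r"
    and boolean_intervals: "x \<in> elts P \<Longrightarrow> boolean_below P x"

section \<open>Matroid schemes\<close>

record 'a rho_poset = "'a poset" +
  rho :: "'a \<Rightarrow> nat"

text \<open>In \<open>M3\<close> the set \<open>meets M x y\<close> is a singleton because \<open>joins M x y\<close> is nonempty;
  \<open>l\<close> is its element.\<close>

locale matroid_scheme = simplicial_poset M
  for M :: "('a, 'm) rho_poset_scheme" +
  assumes M1: "x \<in> elts M \<Longrightarrow> rho M x \<le> rank M x"
    and M2: "\<lbrakk>x \<in> elts M; y \<in> elts M; le M x y\<rbrakk> \<Longrightarrow> rho M x \<le> rho M y"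
    and M3: "\<lbrakk>x \<in> elts M; y \<in> elts M; u \<in> joins M x y; l \<in> meets M x y\<rbrakk>
      \<Longrightarrow> rho M x + rho M y \<ge> rho M u + rho M l"
    and M4: "\<lbrakk>x \<in> elts M; y \<in> elts M; l \<in> meets M x y; rho M x = rho M l\<rbrakk>
      \<Longrightarrow> joins M x y \<noteq> {}"
    and M5: "\<lbrakk>x \<in> elts M; y \<in> elts M; rho M x < rho M y\<rbrakk>
      \<Longrightarrow> \<exists>a\<in>atoms M. le M a y \<and> \<not> le M a x \<and> joins M x a \<noteq> {}"

text \<open>All maximal elements of a matroid scheme have the same \<open>rho\<close>.\<close>

definition total_rank :: "('a, 'm) rho_poset_scheme \<Rightarrow> nat" where
  "total_rank M = rho M (SOME u. u \<in> maximal_elts M (elts M))"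

definition independent_elts :: "('a, 'm) rho_poset_scheme \<Rightarrow> 'a set" where
  "independent_elts M = {x \<in> elts M. rho M x = rank M x}"

definition bases :: "('a, 'm) rho_poset_scheme \<Rightarrow> 'a set" where
  "bases M = maximal_elts M (independent_elts M)"

definition is_loop :: "('a, 'm) rho_poset_scheme \<Rightarrow> 'a \<Rightarrow> bool" where
  "is_loop M a \<longleftrightarrow> a \<in> atoms M \<and> rho M a = 0"

definition is_isthmus :: "('a, 'm) rho_poset_scheme \<Rightarrow> 'a \<Rightarrow> bool" where
  "is_isthmus M a \<longleftrightarrow> a \<in> atoms M \<and> (\<forall>b\<in>bases M. le M a b)"

definition deletion :: "('a, 'm) rho_poset_scheme \<Rightarrow> 'a \<Rightarrow> ('a, 'm) rho_poset_scheme" where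
  "deletion M a = M\<lparr>elts := {x \<in> elts M. \<not> le M a x}\<rparr>"

text \<open>For \<open>w\<close> above \<open>a\<close> the subtraction does not truncate, by \<open>M2\<close>.\<close>

definition contraction :: "('a, 'm) rho_poset_scheme \<Rightarrow> 'a \<Rightarrow> ('a, 'm) rho_poset_scheme" where
  "contraction M a = M\<lparr>elts := {x \<in> elts M. le M a x}, rho := (\<lambda>w. rho M w - rho M a)\<rparr>"

section \<open>The Tutte polynomial\<close>

text \<open>The ring of integer polynomials in two variables is realised as \<open>\<int>[x][y]\<close>.\<close>

definition X :: "int poly poly" where
  "X = [:[:0, 1:]:]"

definition Y :: "int poly poly" where
  "Y = [:0, 1:]"

text \<open>In a matroid scheme neither exponent truncates, by \<open>M2\<close> and \<open>M1\<close> respectively.\<close>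

definition tutte :: "('a, 'm) rho_poset_scheme \<Rightarrow> int poly poly" where
  "tutte M = (\<Sum>w\<in>elts M. (X - 1) ^ (total_rank M - rho M w) * (Y - 1) ^ (rank M w - rho M w))"

end

(* For a not a loop, the sum over S splits into the elements not above a and those above a; the
   two parts match the deletion and the contraction once one knows that the total rank of M - a is
   that of M, or one less if a is an isthmus. This follows from the augmentation property of
   independent elements. If a is a loop, removing a is a bijection from the elements above a onto
   the others which preserves rho and lowers the rank by one, so that paired terms add up to the
   term of the contraction multiplied by 1 + (y - 1) = y. *)

theory Submission
  imports Defs
begin

section \<open>Finite posets and rank functions\<close>

lemma finite_poset_carrier_subset:
  assumes "finite_poset P" and "A \<subseteq> elts P"
  shows "finite_poset (P\<lparr>elts := A\<rparr>)"
  using assms unfolding finite_poset_def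
  by (auto intro: finite_subset reflp_on_subset antisymp_on_subset transp_on_subset)

context
  fixes P :: "('a, 'm) poset_scheme"
  assumes fin: "finite_poset P"
begin

lemma fp_finite: "finite (elts P)"
  and fp_refl: "x \<in> elts P \<Longrightarrow> le P x x"
  and fp_antisym: "\<lbrakk>x \<in> elts P; y \<in> elts P; le P x y; le P y x\<rbrakk> \<Longrightarrow> x = y"
  and fp_trans: "\<lbrakk>x \<in> elts P; y \<in> elts P; z \<in> elts P; le P x y; le P y z\<rbrakk> \<Longrightarrow> le P x z"
  using fin unfolding finite_poset_def
  by (auto dest: reflp_onD antisymp_onD transp_onD)

lemma ex_maximal_elts:
  assumes "A \<subseteq> elts P" "A \<noteq> {}"
  shows "maximal_elts P A \<noteq> {}"
proof -
  let ?R = "\<lambda>x y. le P x y \<and> x \<noteq> y"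
  have "finite A" "transp_on A ?R" "asymp_on A ?R"
    using assms fp_finite finite_subset
      apply blast
     apply (rule transp_onI, use assms fp_antisym fp_trans in blast)
    apply (rule asymp_onI, use assms fp_antisym in blast)
    done
  then obtain m where "m \<in> A" "\<forall>x\<in>A. x \<noteq> m \<longrightarrow> \<not> ?R m x"
    using Finite_Set.bex_max_element[of A ?R] assms(2) by blast
  then show ?thesis
    by (auto simp: maximal_elts_def)
qed

lemma ex_lower_cover:
  assumes "x \<in> elts P" "y \<in> elts P" "le P x y" "x \<noteq> y"
  obtains z where "covers P z y" "le P x z"
proof -
  let ?A = "{z \<in> elts P. le P x z \<and> le P z y \<and> z \<noteq> y}"
  have "x \<in> ?A"
    using assms fp_refl by auto
  then obtain z where z: "z \<in> maximal_elts P ?A"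
    using ex_maximal_elts[of ?A] by blast
  then have "w = z \<or> w = y" if "w \<in> elts P" "le P z w" "le P w y" for w
    using that assms(1) fp_trans[of x z w] by (auto simp: maximal_elts_def)
  with z that assms(2) show thesis
    by (auto simp: maximal_elts_def covers_def)
qed

text \<open>The size of the lower set is the measure for the two inductions on elements
  below.\<close>

lemma less_card_below:
  assumes "x \<in> elts P" "y \<in> elts P" "le P x y" "x \<noteq> y"
  shows "card {w \<in> elts P. le P w x} < card {w \<in> elts P. le P w y}"
proof (rule psubset_card_mono)
  show "finite {w \<in> elts P. le P w y}"
    using fp_finite by simp
  show "{w \<in> elts P. le P w x} \<subset> {w \<in> elts P. le P w y}"
    using assms fp_trans[of _ x y] fp_antisym[of x y] fp_refl[of y] by blast
qed

lemma rank_function_strict_mono: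
  assumes "is_rank_function P r" "x \<in> elts P" "y \<in> elts P" "le P x y" "x \<noteq> y"
  shows "r x < r y"
  using assms(3-5)
proof (induction "card {w \<in> elts P. le P w y}" arbitrary: y rule: less_induct)
  case less
  obtain z where z: "covers P z y" "le P x z"
    using ex_lower_cover less.prems assms(2) by metis
  then have zy: "z \<in> elts P" "le P z y" "z \<noteq> y" "r y = r z + 1"
    using assms(1) by (auto simp: covers_def is_rank_function_def)
  show ?case
    using less.hyps[OF less_card_below] zy z(2) less.prems(1) by (cases "x = z") fastforce+
qed

text \<open>Stepping down through lower covers leads from any element to the minimum, where both
  functions vanish.\<close>

lemma rank_function_unique:
  assumes "is_minimum P m" "is_rank_function P r" "is_rank_function P s" "y \<in> elts P"
  shows "r y = s y"
  using assms(4)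
proof (induction "card {w \<in> elts P. le P w y}" arbitrary: y rule: less_induct)
  case less
  show ?case
  proof (cases "y = m")
    case True
    then show ?thesis
      using assms(1-3) by (simp add: is_rank_function_def)
  next
    case False
    then obtain z where z: "covers P z y"
      using ex_lower_cover[of m y] assms(1) less.prems unfolding is_minimum_def by metis
    then have "z \<in> elts P" "le P z y" "z \<noteq> y" "r y = r z + 1" "s y = s z + 1"
      using assms(2,3) by (auto simp: covers_def is_rank_function_def)
    then show ?thesis
      using less.hyps[OF less_card_below] less.prems by simp
  qed
qed

text \<open>\<open>rank\<close> is a \<open>SOME\<close> choice; exhibiting any rank function
  computes it. The ranks in the deletion and the contraction are found this way.\<close>

lemma rank_eq:
  assumes "is_minimum P m" "is_rank_function P r" "y \<in> elts P"
  shows "rank P y = r y"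
  using rank_function_unique[OF assms(1) _ assms(2,3)] assms(2)
  unfolding rank_def by (metis someI)

end

text \<open>Pins down the \<open>SOME\<close> in \<open>total_rank\<close> by squeezing
  \<open>rho\<close> of an arbitrary maximal element. Only finiteness of the poset is assumed, so it
  applies to deletion and contraction without first proving them matroid schemes.\<close>

lemma total_rank_eq:
  assumes "finite_poset M" "x \<in> elts M"
    and "\<And>y. y \<in> elts M \<Longrightarrow> rho M y \<le> rho M x"
    and "\<And>u. u \<in> maximal_elts M (elts M) \<Longrightarrow> rho M x \<le> rho M u"
  shows "total_rank M = rho M x"
proof -
  have "(SOME u. u \<in> maximal_elts M (elts M)) \<in> maximal_elts M (elts M)"
    using ex_maximal_elts[OF assms(1), of "elts M"] assms(2) by (auto simp: some_in_eq)
  then show ?thesis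
    using assms(3,4) unfolding total_rank_def by (metis (lifting) antisym maximal_elts_def mem_Collect_eq)
qed

section \<open>Simplicial posets\<close>

context simplicial_poset
begin

lemmas finite_elts = fp_finite[OF finite_poset]
  and le_refl = fp_refl[OF finite_poset]
  and le_antisym = fp_antisym[OF finite_poset]
  and le_trans = fp_trans[OF finite_poset]

definition bottom :: 'a where
  "bottom = (THE z. is_minimum P z)"

lemma is_minimum_bottom: "is_minimum P bottom"
  unfolding bottom_def using ex1_minimum by (rule theI')

lemma bottom_in: "bottom \<in> elts P"
  and bottom_le: "x \<in> elts P \<Longrightarrow> le P bottom x"
  using is_minimum_bottom by (auto simp: is_minimum_def)

lemma is_rank_function_rank: "is_rank_function P (rank P)"
  unfolding rank_def using ranked by (rule someI_ex)

lemma rank_bottom: "rank P bottom = 0"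
  using is_rank_function_rank is_minimum_bottom by (simp add: is_rank_function_def)

lemmas rank_strict_mono = rank_function_strict_mono[OF finite_poset is_rank_function_rank]

section \<open>Elements and their sets of atoms\<close>

definition atoms_below :: "'a \<Rightarrow> 'a set" where
  "atoms_below x = {a \<in> atoms P. le P a x}"

lemma atoms_below_subset_elts: "atoms_below x \<subseteq> elts P"
  by (auto simp: atoms_below_def atoms_def)

lemma finite_atoms_below: "finite (atoms_below x)"
  using atoms_below_subset_elts finite_elts by (rule finite_subset)

lemma atoms_below_mono:
  assumes "x \<in> elts P" "y \<in> elts P" "le P x y"
  shows "atoms_below x \<subseteq> atoms_below y"
  using assms le_trans[of _ x y] by (auto simp: atoms_below_def atoms_def)

lemma atom_cases:
  assumes "a \<in> atoms P" "x \<in> elts P" "le P x a"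
  shows "x = bottom \<or> x = a"
  using assms rank_strict_mono[of x a] rank_strict_mono[of bottom x] bottom_in bottom_le
  by (fastforce simp: atoms_def)

lemma atoms_below_bottom: "atoms_below bottom = {}"
proof -
  have False if "a \<in> atoms P" "le P a bottom" for a
    using that le_antisym[of a bottom] bottom_in bottom_le[of a] rank_bottom by (auto simp: atoms_def)
  then show ?thesis
    by (auto simp: atoms_below_def)
qed

lemma atoms_below_atom:
  assumes "a \<in> atoms P"
  shows "atoms_below a = {a}"
  using assms atom_cases[of a] rank_bottom le_refl[of a] by (fastforce simp: atoms_below_def atoms_def)

text \<open>The isomorphism of a lower interval with a Boolean lattice is abstract; it matches atoms with
  singletons, which makes \<^term>\<open>atoms_below\<close> itself such an isomorphism.\<close>

lemma boolean_interval:
  assumes v: "v \<in> elts P"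
  shows le_iff_atoms_below: "\<lbrakk>x \<in> elts P; y \<in> elts P; le P x v; le P y v\<rbrakk>
      \<Longrightarrow> le P x y \<longleftrightarrow> atoms_below x \<subseteq> atoms_below y"
    and ex_atoms_below_eq: "B \<subseteq> atoms_below v
      \<Longrightarrow> \<exists>y\<in>elts P. le P y v \<and> atoms_below y = B"
proof -
  let ?I = "{y \<in> elts P. le P y v}"
  obtain f where bij: "bij_betw f ?I (Pow (atoms_below v))"
    and f_mono: "\<And>y z. \<lbrakk>y \<in> ?I; z \<in> ?I\<rbrakk> \<Longrightarrow> le P y z \<longleftrightarrow> f y \<subseteq> f z"
    using boolean_intervals[OF v] unfolding boolean_below_def atoms_below_def by blast
  have f_surj: "\<exists>y\<in>?I. f y = B" if "B \<subseteq> atoms_below v" for B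
    using bij_betw_imp_surj_on[OF bij] that by (metis (lifting) PowI imageE)
  have f_inj: "y = z" if "y \<in> ?I" "z \<in> ?I" "f y = f z" for y z
    using inj_onD[OF bij_betw_imp_inj_on[OF bij] that(3,1,2)] .
  have f_into: "f y \<subseteq> atoms_below v" if "y \<in> ?I" for y
    using bij_betwE[OF bij] that by blast
  have bottom_I: "bottom \<in> ?I"
    using bottom_in bottom_le v by simp
  have f_bottom: "f bottom = {}"
    using f_surj[of "{}"] f_mono[OF bottom_I] bottom_le by auto
  \<comment> \<open>Only \<open>{}\<close> and \<open>{s}\<close> are subsets of \<open>{s}\<close>,
    so \<open>c\<close> covers \<open>bottom\<close> and has rank one.\<close>
  have singleton_atom: "c \<in> atoms P" if c: "c \<in> ?I" "f c = {s}" for c s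
  proof -
    have "w = bottom \<or> w = c" if "w \<in> elts P" "le P w c" for w
    proof -
      have w: "w \<in> ?I"
        using that c(1) v le_trans[of w c v] by simp
      then have "f w \<subseteq> {s}"
        using f_mono[OF w c(1)] c(2) that(2) by simp
      then have "f w = f bottom \<or> f w = f c"
        by (simp only: c(2) f_bottom subset_singleton_iff)
      then show ?thesis
        using f_inj[OF w bottom_I] f_inj[OF w c(1)] by blast
    qed
    moreover have "c \<noteq> bottom"
      using c(2) f_bottom by auto
    ultimately have "covers P bottom c"
      using c(1) bottom_in bottom_le unfolding covers_def by auto
    then show ?thesis
      using is_rank_function_rank rank_bottom c(1) by (simp add: is_rank_function_def atoms_def)
  qed
  \<comment> \<open>The preimage \<open>d\<close> of a one-point subset of \<open>f c\<close> lies
    below the atom \<open>c\<close> and differs from \<open>bottom\<close>, hence is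
    \<open>c\<close>.\<close>
  have atom_singleton: "\<exists>s. f c = {s}" if c: "c \<in> ?I" "c \<in> atoms P" for c
  proof -
    have "c \<noteq> bottom"
      using c(2) rank_bottom by (auto simp: atoms_def)
    then obtain s where s: "s \<in> f c"
      using f_inj[OF c(1) bottom_I] f_bottom by auto
    then obtain d where d: "d \<in> ?I" "f d = {s}"
      using f_surj[of "{s}"] f_into[OF c(1)] by blast
    then have "d = c"
      using atom_cases[OF c(2), of d] f_mono[OF d(1) c(1)] s f_bottom by auto
    then show ?thesis
      using d(2) by blast
  qed
  show "le P x y \<longleftrightarrow> atoms_below x \<subseteq> atoms_below y"
    if "x \<in> elts P" "y \<in> elts P" "le P x v" "le P y v" for x y
  proof
    assume sub: "atoms_below x \<subseteq> atoms_below y"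
    have I: "x \<in> ?I" "y \<in> ?I"
      using that by auto
    have "s \<in> f y" if s: "s \<in> f x" for s
    proof -
      \<comment> \<open>The point \<open>s\<close> is replaced by the atom that \<open>f\<close>
        sends to \<open>{s}\<close>, since the hypothesis speaks of atoms only.\<close>
      obtain c where c: "c \<in> ?I" "f c = {s}"
        using f_surj[of "{s}"] f_into[OF I(1)] s by blast
      then have "c \<in> atoms_below x"
        using singleton_atom[OF c] f_mono[OF c(1) I(1)] s by (simp add: atoms_below_def)
      then show ?thesis
        using sub f_mono[OF c(1) I(2)] c(2) by (auto simp: atoms_below_def)
    qed
    then show "le P x y"
      using f_mono[OF I] by blast
  qed (use that atoms_below_mono in blast)
  show "\<exists>y\<in>elts P. le P y v \<and> atoms_below y = B" if B: "B \<subseteq> atoms_below v"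
  proof -
    have BI: "b \<in> ?I" "b \<in> atoms P" if "b \<in> B" for b
      using that B by (auto simp: atoms_below_def atoms_def)
    \<comment> \<open>Each \<open>f b\<close> is a singleton, so an atom whose image lies in this
      union shares its image with some \<open>b\<close> and equals it.\<close>
    then obtain y where y: "y \<in> ?I" "f y = (\<Union>b\<in>B. f b)"
      using f_surj[of "\<Union>b\<in>B. f b"] f_into by (metis UN_least)
    have "c \<in> B" if c: "c \<in> atoms_below y" for c
    proof -
      have cI: "c \<in> ?I" "c \<in> atoms P" "le P c y"
        using c y(1) v le_trans[of c y v] by (auto simp: atoms_below_def atoms_def)
      then obtain s where s: "f c = {s}"
        using atom_singleton by blast
      then obtain b where b: "b \<in> B" "s \<in> f b"
        using f_mono[OF cI(1) y(1)] cI(3) y(2) by auto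
      then have "f b = f c"
        using atom_singleton[OF BI[OF b(1)]] s by auto
      then show ?thesis
        using f_inj[OF BI(1)[OF b(1)] cI(1)] b(1) by simp
    qed
    moreover have "b \<in> atoms_below y" if "b \<in> B" for b
      using that BI[OF that] f_mono[OF BI(1)[OF that] y(1)] y(2) by (auto simp: atoms_below_def)
    ultimately show ?thesis
      using y(1) by blast
  qed
qed

text \<open>The common upper bound \<open>v\<close> puts both elements into one Boolean interval.
  Without one, distinct elements may share their atoms, like two parallel edges of a
  multigraph.\<close>

lemma atoms_below_inj:
  assumes "v \<in> elts P" "x \<in> elts P" "y \<in> elts P" "le P x v" "le P y v"
    "atoms_below x = atoms_below y"
  shows "x = y"
  using assms le_iff_atoms_below[of v x y] le_iff_atoms_below[of v y x] le_antisym by blast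

text \<open>A cover adds exactly one atom: adding a single new atom to \<open>x\<close> inside the
  interval below \<open>y\<close> gives an element above \<open>x\<close> and different from it,
  which must be \<open>y\<close>.\<close>

lemma rank_eq_card:
  assumes "x \<in> elts P"
  shows "rank P x = card (atoms_below x)"
proof (rule rank_eq[OF finite_poset is_minimum_bottom _ assms])
  have "card (atoms_below y) = card (atoms_below x) + 1" if c: "covers P x y" for x y
  proof -
    have xy: "x \<in> elts P" "y \<in> elts P" "le P x y" "x \<noteq> y"
      and mid: "\<And>z. \<lbrakk>z \<in> elts P; le P x z; le P z y\<rbrakk> \<Longrightarrow> z = x \<or> z = y"
      using c by (auto simp: covers_def)
    have sub: "atoms_below x \<subset> atoms_below y"
      using atoms_below_mono[OF xy(1-3)] atoms_below_inj[OF xy(2,1,2,3)] le_refl xy(2,4) by blast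
    then obtain b where b: "b \<in> atoms_below y" "b \<notin> atoms_below x"
      by blast
    obtain z where z: "z \<in> elts P" "le P z y" "atoms_below z = insert b (atoms_below x)"
      using ex_atoms_below_eq[OF xy(2), of "insert b (atoms_below x)"] b sub by blast
    moreover have "le P x z"
      using le_iff_atoms_below[OF xy(2,1) z(1)] z xy by auto
    ultimately have "z = y"
      using mid b(2) by blast
    then show ?thesis
      using z(3) b(2) finite_atoms_below by simp
  qed
  moreover have "z = bottom" if "is_minimum P z" for z
    using that is_minimum_bottom ex1_minimum by blast
  ultimately show "is_rank_function P (\<lambda>x. card (atoms_below x))"
    using atoms_below_bottom unfolding is_rank_function_def by (metis card.empty)
qed

section \<open>Joins and meets through atom sets\<close>

text \<open>In the Boolean interval below a join \<open>u\<close>, the element whose atoms form the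
  union already bounds \<open>x\<close> and \<open>y\<close>, so minimality makes it
  \<open>u\<close>.\<close>

lemma joins_eq:
  assumes "x \<in> elts P" "y \<in> elts P"
  shows "joins P x y =
    {u \<in> elts P. le P x u \<and> le P y u \<and> atoms_below u = atoms_below x \<union> atoms_below y}"
proof (intro set_eqI iffI)
  fix u
  assume u: "u \<in> joins P x y"
  then have *: "u \<in> elts P" "le P x u" "le P y u"
    "\<And>w. \<lbrakk>w \<in> elts P; le P x w; le P y w; le P w u\<rbrakk> \<Longrightarrow> w = u"
    by (auto simp: Joins_def minimal_elts_def)
  then obtain z where z: "z \<in> elts P" "le P z u" "atoms_below z = atoms_below x \<union> atoms_below y"
    using ex_atoms_below_eq[of u "atoms_below x \<union> atoms_below y"] atoms_below_mono assms by (metis Un_least)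
  then have "le P x z" "le P y z"
    using le_iff_atoms_below[of u _ z] * assms by auto
  then have "z = u"
    using * z by blast
  then show "u \<in> {u \<in> elts P. le P x u \<and> le P y u \<and> atoms_below u = atoms_below x \<union> atoms_below y}"
    using * z by blast
next
  fix u
  assume u: "u \<in> {u \<in> elts P. le P x u \<and> le P y u \<and> atoms_below u = atoms_below x \<union> atoms_below y}"
  have "w = u" if w: "w \<in> elts P" "le P x w" "le P y w" "le P w u" for w
  proof -
    have "atoms_below w = atoms_below u"
      using atoms_below_mono[of x w] atoms_below_mono[of y w] atoms_below_mono[of w u] u w assms
      by blast
    then show ?thesis
      using atoms_below_inj[of u w u] u w le_refl by blast
  qed
  then show "u \<in> joins P x y"
    using u by (auto simp: Joins_def minimal_elts_def)
qed

lemma ex_join_below: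
  assumes "x \<in> elts P" "y \<in> elts P" "u \<in> elts P" "le P x u" "le P y u"
  obtains z where "z \<in> joins P x y" "le P z u"
proof -
  obtain z where z: "z \<in> elts P" "le P z u" "atoms_below z = atoms_below x \<union> atoms_below y"
    using ex_atoms_below_eq[of u "atoms_below x \<union> atoms_below y"] atoms_below_mono assms
    by (metis Un_least)
  then have "le P x z" "le P y z"
    using le_iff_atoms_below[of u _ z] assms by auto
  with z that assms show thesis
    by (auto simp: joins_eq)
qed

text \<open>A common lower bound above \<open>l\<close> has the same atoms as \<open>l\<close>, and
  both lie below \<open>x\<close>. The condition is only sufficient: each end point of two parallel
  edges is a meet of them.\<close>

lemma meetsI:
  assumes "x \<in> elts P" "y \<in> elts P" "l \<in> elts P" "le P l x" "le P l y"
    "atoms_below x \<inter> atoms_below y \<subseteq> atoms_below l"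
  shows "l \<in> meets P x y"
proof -
  have "w = l" if w: "w \<in> elts P" "le P w x" "le P w y" "le P l w" for w
  proof -
    have "atoms_below w = atoms_below l"
      using atoms_below_mono[of w x] atoms_below_mono[of w y] atoms_below_mono[of l w] w assms
      by blast
    then show ?thesis
      using atoms_below_inj[of x w l] w assms by blast
  qed
  then show ?thesis
    using assms by (auto simp: Meets_def maximal_elts_def)
qed

text \<open>Prepares \<open>M3\<close> and \<open>M4\<close> for an atom and an element not above
  it; both orders are needed because \<open>M4\<close> is not symmetric.\<close>

lemma bottom_in_meets_atom:
  assumes "x \<in> elts P" "a \<in> atoms P" "\<not> le P a x"
  shows "bottom \<in> meets P x a" "bottom \<in> meets P a x"
  using assms by (auto intro!: meetsI simp: bottom_in bottom_le atoms_below_atom)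
    (auto simp: atoms_def bottom_in bottom_le atoms_below_def)

section \<open>Removing an atom from an element\<close>

text \<open>The set difference transported to the Boolean interval below \<open>w\<close>; for
  \<open>w\<close> in the carrier the choice is unique by \<open>atoms_below_inj\<close>.\<close>

definition remove_atom :: "'a \<Rightarrow> 'a \<Rightarrow> 'a" where
  "remove_atom a w = (SOME x. x \<in> elts P \<and> le P x w \<and> atoms_below x = atoms_below w - {a})"

lemma remove_atom:
  assumes "w \<in> elts P"
  shows "remove_atom a w \<in> elts P" "le P (remove_atom a w) w"
    "atoms_below (remove_atom a w) = atoms_below w - {a}"
proof -
  have "\<exists>x. x \<in> elts P \<and> le P x w \<and> atoms_below x = atoms_below w - {a}"
    using ex_atoms_below_eq[OF assms, of "atoms_below w - {a}"] by blast
  from someI_ex[OF this]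
  show "remove_atom a w \<in> elts P" "le P (remove_atom a w) w"
    "atoms_below (remove_atom a w) = atoms_below w - {a}"
    unfolding remove_atom_def by auto
qed

lemma not_le_remove_atom:
  assumes "a \<in> atoms P" "w \<in> elts P"
  shows "\<not> le P a (remove_atom a w)"
  using remove_atom(3)[OF assms(2), of a] assms(1) by (auto simp: atoms_below_def)

lemma join_remove_atom:
  assumes "a \<in> atoms P" "w \<in> elts P" "le P a w"
  shows "w \<in> joins P (remove_atom a w) a"
proof -
  have "a \<in> elts P" "a \<in> atoms_below w"
    using assms by (auto simp: atoms_def atoms_below_def)
  then show ?thesis
    using remove_atom[OF assms(2), of a] assms atoms_below_atom[OF assms(1)]
    by (simp add: joins_eq insert_absorb)
qed

lemma rank_remove_atom:
  assumes "a \<in> atoms P" "w \<in> elts P" "le P a w"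
  shows "rank P w = Suc (rank P (remove_atom a w))"
proof -
  have "a \<in> atoms_below w"
    using assms by (simp add: atoms_below_def)
  then show ?thesis
    using remove_atom[OF assms(2), of a] rank_eq_card assms(2)
      card.remove[OF finite_atoms_below, of a w] by metis
qed

section \<open>Ranks in the deletion and the contraction\<close>

text \<open>The elements not above \<open>a\<close> form a down-set containing
  \<open>bottom\<close>, so covers in it are covers in \<open>P\<close> and the old rank function
  still works.\<close>

lemma rank_deletion:
  assumes "a \<in> atoms P" "x \<in> elts P" "\<not> le P a x"
  shows "rank (P\<lparr>elts := {x \<in> elts P. \<not> le P a x}\<rparr>) x = rank P x"
    (is "rank ?D x = _")
proof (rule rank_eq)
  show "finite_poset ?D"
    by (auto intro: finite_poset_carrier_subset finite_poset)
  have nle: "\<not> le P a bottom"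
    using atoms_below_bottom assms(1) by (auto simp: atoms_below_def)
  then show min: "is_minimum ?D bottom"
    using bottom_in bottom_le by (simp add: is_minimum_def)
  have "z = bottom" if "is_minimum ?D z" for z
    using that min le_antisym by (auto simp: is_minimum_def)
  moreover have "covers P x y" if "covers ?D x y" for x y
    using that assms(1) le_trans[of a _ y] by (auto simp: covers_def atoms_def)
  ultimately show "is_rank_function ?D (rank P)"
    using is_rank_function_rank rank_bottom by (auto simp: is_rank_function_def)
  show "x \<in> elts ?D"
    using assms by simp
qed

text \<open>The elements above \<open>a\<close> form an up-set with minimum \<open>a\<close>, so
  covers persist and ranks shift by one.\<close>

lemma rank_contraction:
  assumes "a \<in> atoms P" "x \<in> elts P" "le P a x"
  shows "rank (P\<lparr>elts := {x \<in> elts P. le P a x}\<rparr>) x = rank P x - 1"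
    (is "rank ?D x = _")
proof (rule rank_eq)
  have a: "a \<in> elts P" "rank P a = 1"
    using assms(1) by (auto simp: atoms_def)
  show "finite_poset ?D"
    by (auto intro: finite_poset_carrier_subset finite_poset)
  show min: "is_minimum ?D a"
    using a le_refl by (simp add: is_minimum_def)
  have "z = a" if "is_minimum ?D z" for z
    using that min le_antisym by (auto simp: is_minimum_def)
  \<comment> \<open>The bound on \<open>rank P x\<close> keeps the natural subtraction from
    truncating.\<close>
  moreover have "covers P x y \<and> rank P x \<ge> 1" if "covers ?D x y" for x y
    using that a le_trans[of a x] rank_strict_mono[of a x] by (fastforce simp: covers_def)
  ultimately show "is_rank_function ?D (\<lambda>x. rank P x - 1)"
    using is_rank_function_rank a by (fastforce simp: is_rank_function_def)
  show "x \<in> elts ?D"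
    using assms by simp
qed

end

section \<open>Matroid schemes\<close>

context matroid_scheme
begin

lemma rho_bottom: "rho M bottom = 0"
  using M1[OF bottom_in] rank_bottom by simp

text \<open>Submodularity \<open>M3\<close> with the meet \<open>bottom\<close>, whose
  \<open>rho\<close> is 0.\<close>

lemma rho_join_atom_le:
  assumes "x \<in> elts M" "a \<in> atoms M" "\<not> le M a x" "u \<in> joins M x a"
  shows "rho M u \<le> rho M x + rho M a"
  using M3[OF assms(1) _ assms(4) bottom_in_meets_atom(1)[OF assms(1-3)]] assms(2) rho_bottom
  by (simp add: atoms_def)

lemma rho_atom_le: "a \<in> atoms M \<Longrightarrow> rho M a \<le> 1"
  using M1[of a] by (simp add: atoms_def)

text \<open>The element \<open>c\<close> is a maximal one with \<open>rho M c = rho M b\<close> inside the ``union'' of \<open>b\<close> and \<open>x\<close>;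
  an atom \<open>e\<close> that raises the \<open>rho\<close> of \<open>c\<close> then also raises that of \<open>b\<close>, by submodularity applied
  to \<open>b \<or> e\<close> and \<open>c\<close>.\<close>

lemma independent_augment:
  assumes b: "b \<in> independent_elts M" and x: "x \<in> elts M" and less: "rho M b < rho M x"
  obtains z where "z \<in> independent_elts M" "le M b z" "z \<noteq> b"
    "atoms_below z \<subseteq> atoms_below b \<union> atoms_below x"
proof -
  \<comment> \<open>The inclusion of atom sets ensures that the augmented element avoids every atom
    that both \<open>b\<close> and \<open>x\<close> avoid.\<close>
  let ?A = "{c \<in> elts M. le M b c \<and> rho M c = rho M b \<and> atoms_below c \<subseteq> atoms_below b \<union> atoms_below x}"
  have b': "b \<in> elts M" "rho M b = rank M b"
    using b by (auto simp: independent_elts_def)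
  then have "b \<in> ?A"
    using le_refl by simp
  then obtain c where "c \<in> maximal_elts M ?A"
    using ex_maximal_elts[OF finite_poset, of ?A] by blast
  then have c: "c \<in> elts M" "le M b c" "rho M c = rho M b"
    "atoms_below c \<subseteq> atoms_below b \<union> atoms_below x"
    and c_max: "\<And>v. \<lbrakk>v \<in> ?A; le M c v\<rbrakk> \<Longrightarrow> v = c"
    by (auto simp: maximal_elts_def)
  obtain e v where e: "e \<in> atoms M" "le M e x" "\<not> le M e c" and v: "v \<in> joins M c e"
    using M5[OF c(1) x] less c(3) by auto
  have e': "e \<in> elts M" "atoms_below e = {e}" "e \<in> atoms_below x" "e \<notin> atoms_below c"
    using e atoms_below_atom by (auto simp: atoms_def atoms_below_def)
  have v': "v \<in> elts M" "le M c v" "le M e v" "atoms_below v = insert e (atoms_below c)"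
    using v joins_eq[OF c(1) e'(1)] e'(2) by auto
  have bv: "le M b v"
    using le_trans[OF b'(1) c(1) v'(1) c(2) v'(2)] .
  \<comment> \<open>If \<open>v\<close> had the same \<open>rho\<close> as \<open>b\<close>, it
    would lie in \<open>?A\<close> strictly above \<open>c\<close>.\<close>
  have "v \<noteq> c"
    using v'(4) e'(4) by auto
  then have "rho M v \<noteq> rho M b"
    using c_max[of v] v' bv c(4) e'(3) by auto
  moreover have "rho M b \<le> rho M v"
    using M2 b'(1) v'(1) bv by blast
  ultimately have rho_v: "rho M b < rho M v"
    by simp
  obtain z where z: "z \<in> joins M b e" "le M z v"
    using ex_join_below[OF b'(1) e'(1) v'(1) bv v'(3)] .
  then have z': "z \<in> elts M" "le M b z" "le M e z" "atoms_below z = insert e (atoms_below b)"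
    using joins_eq[OF b'(1) e'(1)] e'(2) by auto
  have bc: "atoms_below b \<subseteq> atoms_below c"
    using atoms_below_mono[OF b'(1) c(1,2)] .
  have "v \<in> joins M z c"
    using joins_eq[OF z'(1) c(1)] v' z(2) z'(4) bc by auto
  moreover have "b \<in> meets M z c"
    using meetsI[OF z'(1) c(1) b'(1) z'(2) c(2)] z'(4) e'(4) by auto
  ultimately have "rho M v + rho M b \<le> rho M z + rho M c"
    using M3[OF z'(1) c(1)] by blast
  \<comment> \<open>\<open>z\<close> has just one atom more than \<open>b\<close>, so
    \<open>M1\<close> turns this bound into independence.\<close>
  then have "rank M b < rho M z"
    using rho_v c(3) b'(2) by simp
  moreover have "rank M z = Suc (rank M b)"
    using rank_eq_card z'(1,4) b'(1) bc e'(4) finite_atoms_below by (simp add: card_insert_if subset_iff) blast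
  ultimately have "z \<in> independent_elts M"
    using M1[OF z'(1)] z'(1) by (simp add: independent_elts_def)
  moreover have "z \<noteq> b"
    using z'(4) e'(4) bc by auto
  ultimately show thesis
    using that[of z] z'(2,4) e'(3) by simp
qed

section \<open>Bases and the total rank\<close>

lemma rho_le_basis:
  assumes "b \<in> bases M" "x \<in> elts M"
  shows "rho M x \<le> rho M b"
proof (rule ccontr)
  assume "\<not> ?thesis"
  then obtain z where "z \<in> independent_elts M" "le M b z" "z \<noteq> b"
    using independent_augment[of b x] assms by (auto simp: bases_def maximal_elts_def)
  then show False
    using assms(1) by (auto simp: bases_def maximal_elts_def)
qed

lemma basis_in: "b \<in> bases M \<Longrightarrow> b \<in> elts M"
  by (simp add: bases_def maximal_elts_def independent_elts_def)

lemma ex_basis: "bases M \<noteq> {}"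
proof -
  have "bottom \<in> independent_elts M"
    using bottom_in rho_bottom rank_bottom by (simp add: independent_elts_def)
  then show ?thesis
    unfolding bases_def using ex_maximal_elts[OF finite_poset, of "independent_elts M"]
    by (auto simp: independent_elts_def)
qed

text \<open>If \<open>x\<close> had larger \<open>rho\<close>, \<open>M5\<close> would give an atom
  of \<open>x\<close> and a join of it with \<open>u\<close>, which still lies in \<open>D\<close>
  and contradicts maximality. It is applied with \<open>D\<close> the whole carrier and with
  \<open>D\<close> the elements not above an atom.\<close>

lemma rho_maximal_avoiding:
  assumes u: "u \<in> elts M" "u \<in> maximal_elts M D" and x: "x \<in> elts M"
    and D: "\<And>v. \<lbrakk>v \<in> elts M; atoms_below v \<subseteq> atoms_below u \<union> atoms_below x\<rbrakk> \<Longrightarrow> v \<in> D"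
  shows "rho M x \<le> rho M u"
proof (rule ccontr)
  assume "\<not> ?thesis"
  then obtain e v where e: "e \<in> atoms M" "le M e x" "\<not> le M e u" and v: "v \<in> joins M u e"
    using M5[OF u(1) x] by auto
  then have "e \<in> elts M"
    by (simp add: atoms_def)
  then have v': "v \<in> elts M" "le M u v" "le M e v" "atoms_below v = insert e (atoms_below u)"
    using v joins_eq[OF u(1)] atoms_below_atom[OF e(1)] by auto
  then have "v \<in> D"
    using D[of v] e by (auto simp: atoms_below_def)
  then show False
    using u(2) v' e(3) by (auto simp: maximal_elts_def)
qed

lemma total_rank_basis:
  assumes "b \<in> bases M"
  shows "total_rank M = rho M b"
proof (rule total_rank_eq[OF finite_poset basis_in[OF assms] rho_le_basis[OF assms]])
  fix u
  assume "u \<in> maximal_elts M (elts M)"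
  then show "rho M b \<le> rho M u"
    using rho_maximal_avoiding[of u "elts M" b] basis_in[OF assms] by (auto simp: maximal_elts_def)
qed

lemma rho_le_total_rank: "x \<in> elts M \<Longrightarrow> rho M x \<le> total_rank M"
  using ex_basis rho_le_basis total_rank_basis by fastforce

text \<open>A maximal element of the up-set of \<open>a\<close> is maximal in \<open>M\<close> too,
  so its \<open>rho\<close> is the total rank of \<open>M\<close>.\<close>

lemma total_rank_contraction:
  assumes "a \<in> atoms M"
  shows "total_rank (contraction M a) = total_rank M - rho M a"
proof -
  have a: "a \<in> elts M"
    using assms by (simp add: atoms_def)
  let ?C = "contraction M a"
  have maxC: "u \<in> elts M" "u \<in> maximal_elts M (elts M)" "le M a u"
    if "u \<in> maximal_elts ?C (elts ?C)" for u
    using that a le_trans[of a u] by (auto simp: contraction_def maximal_elts_def)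
  have bound: "rho M x \<le> rho M u" if "u \<in> maximal_elts ?C (elts ?C)" "x \<in> elts M" for u x
    using rho_maximal_avoiding[OF maxC(1,2)] that by auto
  have fin: "finite_poset ?C"
    using finite_poset_carrier_subset[OF finite_poset, of "{x \<in> elts M. le M a x}"]
    by (simp add: finite_poset_def contraction_def)
  then obtain u where u: "u \<in> maximal_elts ?C (elts ?C)"
    using ex_maximal_elts[OF fin, of "elts ?C"] a le_refl by (auto simp: contraction_def)
  have "total_rank ?C = rho ?C u"
  proof (rule total_rank_eq[OF fin])
    show "u \<in> elts ?C"
      using u by (simp add: maximal_elts_def)
    show "rho ?C y \<le> rho ?C u" if "y \<in> elts ?C" for y
      using that bound[OF u, of y] by (auto simp: contraction_def)
    show "rho ?C u \<le> rho ?C w" if "w \<in> maximal_elts ?C (elts ?C)" for w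
      using bound[OF that, of u] maxC(1)[OF u] by (auto simp: contraction_def)
  qed
  moreover have "total_rank M = rho M u"
  proof -
    obtain b where "b \<in> bases M" using ex_basis by blast
    then show ?thesis
      using total_rank_basis rho_le_basis[OF _ maxC(1)[OF u]] bound[OF u basis_in] by fastforce
  qed
  ultimately show ?thesis
    by (simp add: contraction_def)
qed

text \<open>Joining with atoms of \<open>x\<close> never brings in \<open>a\<close>, so by
  \<open>rho_maximal_avoiding\<close> every maximal element of the deletion reaches
  \<open>rho M x\<close>.\<close>

lemma total_rank_deletion:
  assumes a: "a \<in> atoms M" and x: "x \<in> elts M" "\<not> le M a x"
    and max: "\<And>y. \<lbrakk>y \<in> elts M; \<not> le M a y\<rbrakk> \<Longrightarrow> rho M y \<le> rho M x"
  shows "total_rank (deletion M a) = rho M x"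
proof -
  let ?D = "deletion M a"
  have "total_rank ?D = rho ?D x"
  proof (rule total_rank_eq)
    show "finite_poset ?D"
      using finite_poset_carrier_subset[OF finite_poset, of "{x \<in> elts M. \<not> le M a x}"]
      by (simp add: deletion_def)
    show "x \<in> elts ?D"
      using x by (simp add: deletion_def)
    show "rho ?D y \<le> rho ?D x" if "y \<in> elts ?D" for y
      using that max by (simp add: deletion_def)
    show "rho ?D x \<le> rho ?D u" if u: "u \<in> maximal_elts ?D (elts ?D)" for u
    proof -
      let ?E = "{x \<in> elts M. \<not> le M a x}"
      have "u \<in> maximal_elts M ?E" "u \<in> elts M" "\<not> le M a u"
        using u by (auto simp: deletion_def maximal_elts_def)
      moreover have "v \<in> ?E" if "v \<in> elts M" "atoms_below v \<subseteq> atoms_below u \<union> atoms_below x" for v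
        using that x(2) \<open>\<not> le M a u\<close> a by (auto simp: atoms_below_def)
      ultimately have "rho M x \<le> rho M u"
        using rho_maximal_avoiding x(1) by blast
      then show ?thesis
        by (simp add: deletion_def)
    qed
  qed
  then show ?thesis
    by (simp add: deletion_def)
qed

lemma rank_deletion_scheme:
  assumes "a \<in> atoms M" "x \<in> elts M" "\<not> le M a x"
  shows "rank (deletion M a) x = rank M x"
  using rank_deletion[OF assms] by (simp add: deletion_def)

text \<open>Reduces the contraction, which also changes \<open>rho\<close>, to the purely
  order-theoretic \<open>rank_contraction\<close>.\<close>

lemma rank_update_rho: "rank (M\<lparr>elts := A, rho := r\<rparr>) = rank (M\<lparr>elts := A\<rparr>)"
  by (simp add: rank_def is_rank_function_def is_minimum_def covers_def)

lemma rank_contraction_scheme: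
  assumes "a \<in> atoms M" "x \<in> elts M" "le M a x"
  shows "rank (contraction M a) x = rank M x - 1"
  using rank_contraction[OF assms] by (simp add: contraction_def rank_update_rho)

section \<open>Isthmuses and the rank of the deletion\<close>

text \<open>If \<open>x\<close> had full \<open>rho\<close>, augmentation from \<open>x\<close>
  would give a maximal \<open>a\<close>-avoiding independent element full \<open>rho\<close> as
  well, making it a basis not above \<open>a\<close>.\<close>

lemma isthmus_rho_less:
  assumes "is_isthmus M a" "x \<in> elts M" "\<not> le M a x"
  shows "rho M x < total_rank M"
proof (rule ccontr)
  assume ge: "\<not> ?thesis"
  have a: "a \<in> atoms M"
    using assms(1) by (simp add: is_isthmus_def)
  let ?A = "{b \<in> independent_elts M. \<not> le M a b}"
  have "bottom \<in> ?A"
    using bottom_in rho_bottom rank_bottom atoms_below_bottom a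
    by (auto simp: independent_elts_def atoms_below_def)
  then obtain b where "b \<in> maximal_elts M ?A"
    using ex_maximal_elts[OF finite_poset, of ?A] by (auto simp: independent_elts_def)
  then have b: "b \<in> independent_elts M" "\<not> le M a b"
    and b_max: "\<And>c. \<lbrakk>c \<in> ?A; le M b c\<rbrakk> \<Longrightarrow> c = b"
    by (auto simp: maximal_elts_def)
  have b': "b \<in> elts M" "rho M b = rank M b"
    using b by (auto simp: independent_elts_def)
  have "rho M x \<le> rho M b"
  proof (rule ccontr)
    assume "\<not> ?thesis"
    then obtain z where z: "z \<in> independent_elts M" "le M b z" "z \<noteq> b"
      "atoms_below z \<subseteq> atoms_below b \<union> atoms_below x"
      using independent_augment[OF b(1) assms(2)] by (metis not_le)
    then have "\<not> le M a z"
      using a b(2) assms(3) by (auto simp: atoms_below_def)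
    then show False
      using b_max z by blast
  qed
  then have tot: "total_rank M \<le> rho M b"
    using ge by simp
  \<comment> \<open>An independent element strictly above \<open>b\<close> would have
    \<open>rho\<close> equal to its rank, exceeding the total rank.\<close>
  have "c = b" if c: "c \<in> independent_elts M" "le M b c" for c
    using rank_strict_mono[of b c] rho_le_total_rank[of c] c b' tot
    by (force simp: independent_elts_def)
  then have "b \<in> bases M"
    using b(1) by (simp add: bases_def maximal_elts_def)
  then show False
    using b(2) assms(1) by (simp add: is_isthmus_def)
qed

text \<open>Removing \<open>a\<close> from a basis lowers \<open>rho\<close> by at most
  \<open>rho M a\<close>, hence by at most 1, and strictly by \<open>isthmus_rho_less\<close>. So
  the drop is exactly 1, and the remaining element has the largest \<open>rho\<close> in the
  deletion.\<close>

lemma isthmus_rho: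
  assumes "is_isthmus M a"
  shows "rho M a = 1" "total_rank M = Suc (total_rank (deletion M a))"
proof -
  have a: "a \<in> atoms M"
    using assms by (simp add: is_isthmus_def)
  obtain b where b: "b \<in> bases M"
    using ex_basis by blast
  have b': "b \<in> elts M" "le M a b"
    using assms b basis_in by (auto simp: is_isthmus_def)
  let ?y = "remove_atom a b"
  have y: "?y \<in> elts M" "\<not> le M a ?y"
    using remove_atom(1)[OF b'(1)] not_le_remove_atom[OF a b'(1)] by auto
  have "rho M b \<le> rho M ?y + rho M a"
    using rho_join_atom_le[OF y(1) a y(2) join_remove_atom[OF a b']] .
  moreover have "rho M ?y < rho M b"
    using isthmus_rho_less[OF assms y] total_rank_basis[OF b] by simp
  ultimately have rho_a: "rho M a = 1" and eq: "rho M b = Suc (rho M ?y)"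
    using rho_atom_le[OF a] by simp_all
  have "total_rank (deletion M a) = rho M ?y"
    using isthmus_rho_less[OF assms] total_rank_basis[OF b] eq
    by (intro total_rank_deletion[OF a y]) fastforce
  with rho_a eq total_rank_basis[OF b]
  show "rho M a = 1" "total_rank M = Suc (total_rank (deletion M a))"
    by simp_all
qed

lemma total_rank_deletion_non_isthmus:
  assumes "a \<in> atoms M" "\<not> is_isthmus M a"
  shows "total_rank (deletion M a) = total_rank M"
proof -
  obtain b where b: "b \<in> bases M" "\<not> le M a b"
    using assms by (auto simp: is_isthmus_def)
  then show ?thesis
    using total_rank_deletion[OF assms(1) basis_in[OF b(1)] b(2)] rho_le_basis[OF b(1)]
      total_rank_basis[OF b(1)] by simp
qed

section \<open>Deletion and contraction\<close>

abbreviation term_at :: "'a \<Rightarrow> int poly poly" where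
  "term_at w \<equiv> (X - 1) ^ (total_rank M - rho M w) * (Y - 1) ^ (rank M w - rho M w)"

lemma tutte_split:
  assumes "a \<in> elts M"
  shows "tutte M = (\<Sum>w | w \<in> elts M \<and> \<not> le M a w. term_at w) + (\<Sum>w | w \<in> elts M \<and> le M a w. term_at w)"
proof -
  have "elts M = {w \<in> elts M. \<not> le M a w} \<union> {w \<in> elts M. le M a w}"
    by blast
  then show ?thesis
    unfolding tutte_def by (subst sum.union_disjoint[symmetric]) (use finite_elts in auto)
qed

text \<open>Total rank, \<open>rho\<close> and rank all drop by one, so both exponents are
  unchanged.\<close>

lemma tutte_contraction:
  assumes a: "a \<in> atoms M" and rho_a: "rho M a = 1"
  shows "tutte (contraction M a) = (\<Sum>w | w \<in> elts M \<and> le M a w. term_at w)"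
proof -
  have elts: "elts (contraction M a) = {w \<in> elts M. le M a w}"
    by (simp add: contraction_def)
  show ?thesis
    unfolding tutte_def elts
  proof (rule sum.cong[OF refl])
    fix w
    assume "w \<in> {w \<in> elts M. le M a w}"
    then have w: "w \<in> elts M" "le M a w"
      by auto
    have "1 \<le> rho M w"
      using M2[of a w] w a rho_a by (simp add: atoms_def)
    moreover have "rho (contraction M a) w = rho M w - 1"
      by (simp add: contraction_def rho_a)
    ultimately show "(X - 1) ^ (total_rank (contraction M a) - rho (contraction M a) w) *
        (Y - 1) ^ (rank (contraction M a) w - rho (contraction M a) w) = term_at w"
      using total_rank_contraction[OF a] rank_contraction_scheme[OF a w] rho_a by simp
  qed
qed

text \<open>Used with \<open>k = 0\<close> for a non-isthmus and \<open>k = 1\<close> for an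
  isthmus; the last hypothesis keeps the exponent of \<open>X - 1\<close> exact.\<close>

lemma tutte_deletion:
  assumes "a \<in> atoms M" "total_rank M = k + total_rank (deletion M a)"
    and "\<And>w. \<lbrakk>w \<in> elts M; \<not> le M a w\<rbrakk> \<Longrightarrow> rho M w + k \<le> total_rank M"
  shows "(\<Sum>w | w \<in> elts M \<and> \<not> le M a w. term_at w) = (X - 1) ^ k * tutte (deletion M a)"
proof -
  have elts: "elts (deletion M a) = {w \<in> elts M. \<not> le M a w}"
    by (simp add: deletion_def)
  show ?thesis
    unfolding tutte_def elts sum_distrib_left
  proof (rule sum.cong[OF refl])
    fix w
    assume "w \<in> {w \<in> elts M. \<not> le M a w}"
    then have w: "w \<in> elts M" "\<not> le M a w"
      by auto
    have "total_rank M - rho M w = k + (total_rank (deletion M a) - rho M w)"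
      using assms(2) assms(3)[OF w] by simp
    moreover have "rho (deletion M a) w = rho M w"
      by (simp add: deletion_def)
    ultimately show "term_at w = (X - 1) ^ k * ((X - 1) ^ (total_rank (deletion M a) - rho (deletion M a) w) *
        (Y - 1) ^ (rank (deletion M a) w - rho (deletion M a) w))"
      using rank_deletion_scheme[OF assms(1) w] by (simp add: power_add mult.assoc)
  qed
qed

section \<open>Loops\<close>

lemma rho_remove_loop:
  assumes "is_loop M a" "w \<in> elts M" "le M a w"
  shows "rho M (remove_atom a w) = rho M w"
proof -
  have a: "a \<in> atoms M" "rho M a = 0"
    using assms(1) by (auto simp: is_loop_def)
  note r = remove_atom[OF assms(2), of a]
  show ?thesis
    using rho_join_atom_le[OF r(1) a(1) not_le_remove_atom[OF a(1) assms(2)]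
        join_remove_atom[OF a(1) assms(2,3)]] M2[OF r(1) assms(2) r(2)] a(2) by simp
qed

text \<open>Two joins \<open>u\<close>, \<open>w\<close> of \<open>x\<close> with a loop have \<open>x\<close> as a meet of the same \<open>rho\<close>, so by \<open>M4\<close> they
  lie in a common Boolean interval and hence coincide.\<close>

lemma bij_betw_remove_loop:
  assumes loop: "is_loop M a"
  shows "bij_betw (remove_atom a) {w \<in> elts M. le M a w} {w \<in> elts M. \<not> le M a w}"
proof (rule bij_betw_imageI)
  have a: "a \<in> atoms M" "rho M a = 0" "a \<in> elts M" "atoms_below a = {a}"
    using loop atoms_below_atom by (auto simp: is_loop_def atoms_def)
  show "inj_on (remove_atom a) {w \<in> elts M. le M a w}"
  proof (rule inj_onI)
    fix u w
    assume "u \<in> {w \<in> elts M. le M a w}" "w \<in> {w \<in> elts M. le M a w}"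
      and eq: "remove_atom a u = remove_atom a w"
    then have u: "u \<in> elts M" "le M a u" and w: "w \<in> elts M" "le M a w"
      by auto
    let ?x = "remove_atom a u"
    have x: "?x \<in> elts M" "le M ?x u" "le M ?x w" "atoms_below ?x = atoms_below u - {a}"
      using remove_atom[OF u(1), of a] remove_atom[OF w(1), of a] eq by auto
    have at_eq: "atoms_below u = atoms_below w"
      using remove_atom(3)[OF u(1), of a] remove_atom(3)[OF w(1), of a] eq u w a(1)
      by (auto simp: atoms_below_def)
    show "u = w"
    proof (rule ccontr)
      assume neq: "u \<noteq> w"
      have "?x \<in> meets M u w"
      proof -
        \<comment> \<open>\<open>meetsI\<close> does not apply, as \<open>a\<close> is an atom of
          \<open>u\<close> and \<open>w\<close> but not of \<open>?x\<close>. Instead,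
          \<open>?x\<close> is one rank below both, so a larger common lower bound would equal
          both.\<close>
        have "y = ?x" if y: "y \<in> elts M" "le M y u" "le M y w" "le M ?x y" for y
        proof (rule ccontr)
          assume "y \<noteq> ?x"
          then have "rank M ?x < rank M y"
            using rank_strict_mono[OF x(1) y(1,4)] by simp
          then have "\<not> rank M y < rank M u" "\<not> rank M y < rank M w"
            using rank_remove_atom[OF a(1) u] rank_remove_atom[OF a(1) w] eq by simp_all
          then have "y = u" "y = w"
            using rank_strict_mono[OF y(1)] u(1) w(1) y(2,3) by blast+
          then show False
            using neq by simp
        qed
        then show ?thesis
          using x by (auto simp: Meets_def maximal_elts_def)
      qed
      then have "joins M u w \<noteq> {}"
        using M4[OF u(1) w(1)] rho_remove_loop[OF loop u] by simp
      then obtain v where "v \<in> elts M" "le M u v" "le M w v"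
        using joins_eq[OF u(1) w(1)] by blast
      then show False
        using atoms_below_inj[of v u w] u(1) w(1) at_eq neq by blast
    qed
  qed
  show "remove_atom a ` {w \<in> elts M. le M a w} = {w \<in> elts M. \<not> le M a w}"
  proof (intro equalityI subsetI)
    fix x
    assume "x \<in> {w \<in> elts M. \<not> le M a w}"
    then have x: "x \<in> elts M" "\<not> le M a x"
      by auto
    \<comment> \<open>\<open>M4\<close> starts from \<open>a\<close>, whose \<open>rho\<close>
      agrees with that of the meet \<open>bottom\<close>.\<close>
    then have "joins M a x \<noteq> {}"
      using M4[OF a(3) x(1) bottom_in_meets_atom(2)[OF x(1) a(1) x(2)]] a(2) rho_bottom by simp
    then obtain u where u: "u \<in> elts M" "le M a u" "le M x u" "atoms_below u = insert a (atoms_below x)"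
      using joins_eq[OF a(3) x(1)] a(4) by auto
    have "remove_atom a u = x"
      using atoms_below_inj[OF u(1) remove_atom(1)[OF u(1)] x(1) remove_atom(2)[OF u(1)] u(3)]
        remove_atom(3)[OF u(1), of a] u(4) x(2) by (auto simp: atoms_below_def)
    then show "x \<in> remove_atom a ` {w \<in> elts M. le M a w}"
      using u by blast
  qed (use remove_atom(1) not_le_remove_atom[OF a(1)] in auto)
qed

lemma tutte_loop:
  assumes loop: "is_loop M a"
  shows "tutte M = Y * tutte (contraction M a)"
proof -
  have a: "a \<in> atoms M" "rho M a = 0" "a \<in> elts M"
    using loop by (auto simp: is_loop_def atoms_def)
  let ?U = "{w \<in> elts M. le M a w}"
  have elts: "elts (contraction M a) = ?U"
    by (simp add: contraction_def)
  have "tutte M = (\<Sum>w\<in>?U. term_at (remove_atom a w)) + (\<Sum>w\<in>?U. term_at w)"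
    using tutte_split[OF a(3)] sum.reindex_bij_betw[OF bij_betw_remove_loop[OF loop], of term_at]
    by simp
  also have "\<dots> = (\<Sum>w\<in>?U. Y * ((X - 1) ^ (total_rank (contraction M a) - rho (contraction M a) w) *
        (Y - 1) ^ (rank (contraction M a) w - rho (contraction M a) w)))"
    unfolding sum.distrib[symmetric]
  proof (rule sum.cong[OF refl])
    fix w
    assume "w \<in> ?U"
    then have w: "w \<in> elts M" "le M a w"
      by auto
    let ?x = "remove_atom a w"
    have rank_w: "rank M w = Suc (rank M ?x)"
      using rank_remove_atom[OF a(1) w] .
    \<comment> \<open>Makes the subtraction exact: the term of \<open>w\<close> has exactly one
      factor \<open>Y - 1\<close> more than that of \<open>?x\<close>, so their sum gains the factor
      \<open>1 + (Y - 1)\<close>.\<close>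
    have "rho M w \<le> rank M ?x"
      using M1[OF remove_atom(1)[OF w(1)], of a] rho_remove_loop[OF loop w] by simp
    then have "rank M w - rho M w = Suc (rank M ?x - rho M w)"
      using rank_w by simp
    moreover have "rho (contraction M a) w = rho M w"
      by (simp add: contraction_def a(2))
    ultimately show "term_at ?x + term_at w =
      Y * ((X - 1) ^ (total_rank (contraction M a) - rho (contraction M a) w) *
        (Y - 1) ^ (rank (contraction M a) w - rho (contraction M a) w))"
      using total_rank_contraction[OF a(1)] rank_contraction_scheme[OF a(1) w] a(2)
        rho_remove_loop[OF loop w] rank_w
      by (simp add: algebra_simps)
  qed
  finally show ?thesis
    by (simp add: tutte_def elts sum_distrib_left)
qed

end

theorem theorem10p2:
  fixes M :: "'a rho_poset" and a :: 'a
  assumes "matroid_scheme M" and "a \<in> atoms M"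
  shows "(\<not> is_loop M a \<and> \<not> is_isthmus M a \<longrightarrow>
            tutte M = tutte (deletion M a) + tutte (contraction M a)) \<and>
         (is_loop M a \<longrightarrow> tutte M = Y * tutte (contraction M a)) \<and>
         (is_isthmus M a \<longrightarrow>
            tutte M = (X - 1) * tutte (deletion M a) + tutte (contraction M a))"
proof -
  interpret matroid_scheme M
    by (fact assms(1))
  have a: "a \<in> elts M"
    using assms(2) by (simp add: atoms_def)
  show ?thesis
  proof (intro conjI impI)
    assume *: "\<not> is_loop M a \<and> \<not> is_isthmus M a"
    then have "rho M a = 1"
      using rho_atom_le[OF assms(2)] assms(2) by (auto simp: is_loop_def le_Suc_eq)
    then show "tutte M = tutte (deletion M a) + tutte (contraction M a)"
      using tutte_split[OF a] tutte_contraction[OF assms(2)] tutte_deletion[OF assms(2), of 0]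
        total_rank_deletion_non_isthmus[OF assms(2)] * rho_le_total_rank by simp
  next
    assume "is_isthmus M a"
    then show "tutte M = (X - 1) * tutte (deletion M a) + tutte (contraction M a)"
      using tutte_split[OF a] tutte_contraction[OF assms(2)] tutte_deletion[OF assms(2), of 1]
        isthmus_rho isthmus_rho_less by (simp add: Suc_le_eq)
  qed (rule tutte_loop)
qed

end
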